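(* Let $X$ be a set, and $T$ an overlap-free subset of $\langle X\rangle\setminus\{1\}$. Then every element of $\langle X:\mathbf{i}(T)\rangle$ can be written uniquely as the product of a (possibly empty) string of elements of $X\cup\mathbf{i}(T)$ in which no element $\mathbf{i}(w)$ ($w\in T$) is immediately preceded or followed by the corresponding string $w$ (the expression of $w$ as a word in $X$).
   Context: $\langle X\rangle$ is the free monoid on $X$. For $T\subseteq\langle X\rangle$, $\langle X:\mathbf{i}(T)\rangle$ denotes the monoid obtained from $\langle X\rangle$ by universally adjoining a two-sided inverse $\mathbf{i}(w)$ to each $w\in T$, i.e. the monoid presented by generators $X\cup\{\mathbf{i}(w): w\in T\}$ (with the $\mathbf{i}(w)$ distinct new symbols) and relations $w\,\mathbf{i}(w)=1=\mathbf{i}(w)\,w$ for $w\in T$. Write $\mathbf{i}(T)=\{\mathbf{i}(w):w\in T\}$. Two nonidentity elements of $\langle X\rangle$ (possibly equal) are said to overlap if one of them can be written $ab$ and the other $bc$ with $a,b,c\in\langle X\rangle$, $b\neq 1$, and at most one of $a$ and $c$ equal to $1$. A subset $T\subseteq\langle X\rangle\setminus\{1\}$ is overlap-free if no pair of elements of $T$ (distinct or not) overlap. *)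

theory Defs
  imports "HOL-Algebra.Group"
begin

text \<open>The free monoid on a set \<open>X\<close> is \<open>lists X\<close> under concatenation, with identity \<open>[]\<close>.\<close>

inductive_set pres_cong :: "'g set \<Rightarrow> ('g list \<times> 'g list) set \<Rightarrow> ('g list \<times> 'g list) set"
  for G :: "'g set" and R :: "('g list \<times> 'g list) set"
where
  rel: "(u, v) \<in> R \<Longrightarrow> u \<in> lists G \<Longrightarrow> v \<in> lists G \<Longrightarrow> (u, v) \<in> pres_cong G R"
| refl: "u \<in> lists G \<Longrightarrow> (u, u) \<in> pres_cong G R"
| sym: "(u, v) \<in> pres_cong G R \<Longrightarrow> (v, u) \<in> pres_cong G R"
| trans: "(u, v) \<in> pres_cong G R \<Longrightarrow> (v, w) \<in> pres_cong G R \<Longrightarrow> (u, w) \<in> pres_cong G R"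
| append: "(u, v) \<in> pres_cong G R \<Longrightarrow> (u', v') \<in> pres_cong G R \<Longrightarrow>
    (u @ u', v @ v') \<in> pres_cong G R"

definition pres_monoid :: "'g set \<Rightarrow> ('g list \<times> 'g list) set \<Rightarrow> 'g list set monoid" where
  "pres_monoid G R =
    \<lparr>carrier = lists G // pres_cong G R,
     mult = (\<lambda>A B. \<Union>u\<in>A. \<Union>v\<in>B. pres_cong G R `` {u @ v}),
     one = pres_cong G R `` {[]}\<rparr>"

definition pres_gen :: "'g set \<Rightarrow> ('g list \<times> 'g list) set \<Rightarrow> 'g \<Rightarrow> 'g list set" where
  "pres_gen G R x = pres_cong G R `` {[x]}"

lemma equiv_pres_cong: "equiv (lists G) (pres_cong G R)"
proof (rule equivI)
  have "u \<in> lists G \<and> v \<in> lists G" if "(u, v) \<in> pres_cong G R" for u v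
    using that by induction auto
  then show "pres_cong G R \<subseteq> lists G \<times> lists G" by auto
  show "refl_on (lists G) (pres_cong G R)"
    by (auto intro: refl_onI pres_cong.refl)
  show "sym (pres_cong G R)" by (auto intro: symI pres_cong.sym)
  show "trans (pres_cong G R)" by (auto intro: transI pres_cong.trans)
qed

lemma mult_pres_monoid:
  assumes "u \<in> lists G" "v \<in> lists G"
  shows "pres_cong G R `` {u} \<otimes>\<^bsub>pres_monoid G R\<^esub> pres_cong G R `` {v} = pres_cong G R `` {u @ v}"
proof -
  have "congruent2 (pres_cong G R) (pres_cong G R) (\<lambda>u v. pres_cong G R `` {u @ v})"
    by (rule congruent2I')
      (metis equiv_class_eq[OF equiv_pres_cong] pres_cong.append)
  from UN_equiv_class2[OF equiv_pres_cong equiv_pres_cong this assms]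
  show ?thesis by (simp add: pres_monoid_def)
qed

lemma monoid_pres_monoid: "monoid (pres_monoid G R)"
proof -
  have c: "carrier (pres_monoid G R) = (\<lambda>u. pres_cong G R `` {u}) ` lists G"
    by (auto simp: pres_monoid_def quotient_def)
  have o: "\<one>\<^bsub>pres_monoid G R\<^esub> = pres_cong G R `` {[]}"
    by (simp add: pres_monoid_def)
  have m: "pres_cong G R `` {u} \<otimes>\<^bsub>pres_monoid G R\<^esub> pres_cong G R `` {v} = pres_cong G R `` {u @ v}"
    if "\<forall>x\<in>set u. x \<in> G" "\<forall>x\<in>set v. x \<in> G" for u v
    using that by (intro mult_pres_monoid) auto
  show ?thesis
    by (rule monoidI) (unfold c o, auto simp: m ball_Un simp del: Image_singleton_iff
        intro!: imageI equalityI)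
qed

datatype 'a letter = Gen 'a | Inv "'a list"

definition letters :: "'a set \<Rightarrow> 'a list set \<Rightarrow> 'a letter set" where
  "letters X T = Gen ` X \<union> Inv ` T"

definition inverse_rels :: "'a list set \<Rightarrow> ('a letter list \<times> 'a letter list) set" where
  "inverse_rels T =
    {(map Gen w @ [Inv w], []) | w. w \<in> T} \<union> {([Inv w] @ map Gen w, []) | w. w \<in> T}"

definition adjoin_inverses :: "'a set \<Rightarrow> 'a list set \<Rightarrow> 'a letter list set monoid" where
  "adjoin_inverses X T = pres_monoid (letters X T) (inverse_rels T)"

text \<open>Strings are lists of symbols; \<open>string_prod\<close> multiplies the corresponding monoid elements.\<close>

definition string_prod :: "'a set \<Rightarrow> 'a list set \<Rightarrow> 'a letter list \<Rightarrow> 'a letter list set" where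
  "string_prod X T s =
    foldr (\<lambda>x g. pres_gen (letters X T) (inverse_rels T) x \<otimes>\<^bsub>adjoin_inverses X T\<^esub> g) s
      \<one>\<^bsub>adjoin_inverses X T\<^esub>"

definition reduced :: "'a list set \<Rightarrow> 'a letter list \<Rightarrow> bool" where
  "reduced T s \<longleftrightarrow>
    (\<forall>w\<in>T. \<nexists>p q. s = p @ map Gen w @ [Inv w] @ q \<or> s = p @ [Inv w] @ map Gen w @ q)"

text \<open>Here \<open>a\<close>, \<open>b\<close>, \<open>c\<close> range over all words over the type; as factors of \<open>u\<close> and \<open>v\<close>
  they lie in \<open>lists X\<close> whenever \<open>u\<close> and \<open>v\<close> do. Since \<open>b\<close> is nonempty, only nonempty words
  can overlap.\<close>

definition overlap :: "'a list \<Rightarrow> 'a list \<Rightarrow> bool" where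
  "overlap u v \<longleftrightarrow>
    (\<exists>a b c. (u = a @ b \<and> v = b @ c \<or> v = a @ b \<and> u = b @ c) \<and>
      b \<noteq> [] \<and> \<not> (a = [] \<and> c = []))"

definition overlap_free :: "'a list set \<Rightarrow> bool" where
  "overlap_free T \<longleftrightarrow> (\<forall>u\<in>T. \<forall>v\<in>T. \<not> overlap u v)"

end

theory Submission
  imports Defs
begin

text \<open>The van der Waerden trick: left multiplication by a letter, followed by the cancellation (if
  any) that the new letter creates at the front, is an action of the letters on reduced strings.
  Since \<open>T\<close> is overlap-free, prefixing a word \<open>w \<in> T\<close> letter by letter can only cancel at its last
  step, and only against \<open>Inv w\<close>; hence \<open>w\<close> and \<open>Inv w\<close> act as mutually inverse maps and the
  action factors through the monoid. A reduced string is recovered from the monoid element it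
  represents by applying that element to the empty string.\<close>

section \<open>Cancellation at the front of a string\<close>

definition cancels :: "'a list set \<Rightarrow> 'a letter list \<Rightarrow> 'a letter list \<Rightarrow> bool" where
  "cancels T s q \<longleftrightarrow> (\<exists>w\<in>T. s = map Gen w @ Inv w # q \<or> s = Inv w # map Gen w @ q)"

text \<open>The description operator is meaningful because \<open>cancels_unique\<close> leaves at
  most one remainder when \<open>[] \<notin> T\<close>; at most one pair is deleted per
  push.\<close>

definition push :: "'a list set \<Rightarrow> 'a letter \<Rightarrow> 'a letter list \<Rightarrow> 'a letter list" where
  "push T x s = (if \<exists>q. cancels T (x # s) q then THE q. cancels T (x # s) q else x # s)"

text \<open>The first \<open>Inv\<close> marks where the leading block of \<open>Gen\<close> letters
  ends, so the block, the marker and the rest can all be read off.\<close>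

lemma map_Gen_Inv_eq_iff:
  "map Gen u @ Inv v # q = map Gen u' @ Inv v' # q' \<longleftrightarrow> u = u' \<and> v = v' \<and> q = q'"
proof (induction u arbitrary: u')
  case Nil
  then show ?case by (cases u') auto
next
  case (Cons a u)
  then show ?case by (cases u') auto
qed

lemma map_Gen_eq_append_Inv:
  assumes "map Gen b @ s = map Gen w @ Inv w # q"
  shows "\<exists>c. w = b @ c \<and> s = map Gen c @ Inv w # q"
  using assms
proof (induction b arbitrary: w s q rule: rev_induct)
  case Nil
  then show ?case by simp
next
  case (snoc a b)
  from snoc.prems have "map Gen b @ (Gen a # s) = map Gen w @ Inv w # q" by simp
  from snoc.IH[OF this] obtain c where c: "w = b @ c" "Gen a # s = map Gen c @ Inv w # q" by blast
  then show ?case by (cases c) auto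
qed

text \<open>Words of \<open>T\<close> are nonempty, so the first letter tells the two forms apart.
  The first \<open>Inv\<close> then determines the word, and with it the remainder.\<close>

lemma cancels_unique:
  assumes "[] \<notin> T" "cancels T s q" "cancels T s q'"
  shows "q = q'"
proof -
  have ne: "map Gen u @ Inv u # p \<noteq> Inv v # map Gen v @ p'" if "u \<in> T" for u v p p'
    using that assms(1) by (cases u) auto
  show ?thesis
    using assms(2,3) ne unfolding cancels_def
    by (elim bexE disjE) (auto simp: map_Gen_Inv_eq_iff ne[symmetric])
qed

lemma push_cancel: "[] \<notin> T \<Longrightarrow> cancels T (x # s) q \<Longrightarrow> push T x s = q"
  unfolding push_def by (auto intro: cancels_unique)

section \<open>Reduced strings under the action\<close>

lemma reduced_append: "reduced T (p @ s) \<Longrightarrow> reduced T s"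
  unfolding reduced_def by (metis append.assoc)

text \<open>A forbidden factor of \<open>x # s\<close> lies inside \<open>s\<close> or starts at
  \<open>x\<close>, so only the front has to be inspected.\<close>

lemma reduced_Cons: "reduced T (x # s) \<longleftrightarrow> reduced T s \<and> (\<nexists>q. cancels T (x # s) q)"
proof
  assume r: "reduced T (x # s)"
  then have "reduced T s" using reduced_append[of T "[x]" s] by simp
  moreover have "\<nexists>q. cancels T (x # s) q"
  proof
    assume "\<exists>q. cancels T (x # s) q"
    then obtain w q where "w \<in> T"
        "x # s = [] @ map Gen w @ [Inv w] @ q \<or> x # s = [] @ [Inv w] @ map Gen w @ q"
      by (auto simp: cancels_def)
    then show False using r unfolding reduced_def by blast
  qed
  ultimately show "reduced T s \<and> (\<nexists>q. cancels T (x # s) q)" by blast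
next
  assume r: "reduced T s \<and> (\<nexists>q. cancels T (x # s) q)"
  show "reduced T (x # s)"
    unfolding reduced_def
  proof (intro ballI notI, elim exE)
    fix w p q
    assume "w \<in> T" and
      "x # s = p @ map Gen w @ [Inv w] @ q \<or> x # s = p @ [Inv w] @ map Gen w @ q"
    then show False
      using r by (cases p) (auto simp: reduced_def cancels_def)
  qed
qed

lemma push_reduced: "reduced T (x # s) \<Longrightarrow> push T x s = x # s"
  by (simp add: push_def reduced_Cons)

text \<open>Suffixes of a reduced string are reduced, so no push cancels. With \<open>s = []\<close>
  this recovers a reduced string from its action.\<close>

lemma foldr_push_reduced: "reduced T (p @ s) \<Longrightarrow> foldr (push T) p s = p @ s"
  by (induction p) (auto simp: push_reduced reduced_Cons)

lemma cancels_suffix: "cancels T s q \<Longrightarrow> \<exists>p. s = p @ q"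
proof -
  assume "cancels T s q"
  then obtain w where "s = (map Gen w @ [Inv w]) @ q \<or> s = (Inv w # map Gen w) @ q"
    by (auto simp: cancels_def)
  then show ?thesis by blast
qed

lemma reduced_push:
  assumes "[] \<notin> T" "reduced T s"
  shows "reduced T (push T x s)"
proof (cases "\<exists>q. cancels T (x # s) q")
  case True
  then obtain q where q: "cancels T (x # s) q" by blast
  obtain p where p: "x # s = p @ q" using cancels_suffix[OF q] by blast
  \<comment> \<open>Makes \<open>q\<close> a suffix of \<open>s\<close> itself, not merely of
    \<open>x # s\<close>, so that it inherits reducedness.\<close>
  have "p \<noteq> []" using q p by (auto simp: cancels_def)
  then have "reduced T q" using p assms(2) by (cases p) (auto dest: reduced_append)
  then show ?thesis using push_cancel[OF assms(1) q] by simp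
next
  case False
  then show ?thesis using assms(2) by (simp add: push_def reduced_Cons)
qed

lemma reduced_foldr_push: "[] \<notin> T \<Longrightarrow> reduced T s \<Longrightarrow> reduced T (foldr (push T) u s)"
  by (induction u) (auto intro: reduced_push)

section \<open>Words of \<open>T\<close> and their inverse letters act as mutually inverse
  maps\<close>

text \<open>If \<open>s\<close> starts with \<open>w\<close>, pushing \<open>Inv w\<close> strips
  that word and the letters of \<open>w\<close> restore it. Otherwise \<open>Inv w\<close> stays
  until the first letter of \<open>w\<close>, pushed last, completes the pair.\<close>

lemma foldr_push_word_inv:
  assumes "[] \<notin> T" "w \<in> T" "reduced T s"
  shows "foldr (push T) (map Gen w @ [Inv w]) s = s"
proof (cases "\<exists>q. s = map Gen w @ q")
  case True
  then obtain q where q: "s = map Gen w @ q" by blast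
  then have "push T (Inv w) s = q"
    using assms by (intro push_cancel) (auto simp: cancels_def)
  then show ?thesis using q assms(3) by (simp add: foldr_push_reduced)
next
  case False
  obtain a b where ab: "w = a # b" using assms(1,2) by (cases w) auto
  have r: "reduced T (Inv w # s)"
    using False assms(3) by (auto simp: reduced_Cons cancels_def Cons_eq_append_conv)
  \<comment> \<open>A cancellation here would need the whole block before \<open>Inv w\<close> to be
    \<open>w\<close>, but \<open>b'\<close> is shorter.\<close>
  have "reduced T (map Gen b' @ Inv w # s)" if "length b' < length w" for b'
    using that
  proof (induction b')
    case Nil
    then show ?case using r by simp
  next
    case (Cons x b')
    then show ?case
      using map_Gen_Inv_eq_iff[of "x # b'" w s]
      by (auto simp: reduced_Cons cancels_def)
  qed
  then have "foldr (push T) (map Gen b) (Inv w # s) = map Gen b @ Inv w # s"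
    using ab by (intro foldr_push_reduced) simp
  moreover have "push T (Gen a) (map Gen b @ Inv w # s) = s"
    using assms(1,2) ab by (intro push_cancel) (auto simp: cancels_def intro!: bexI[of _ w])
  ultimately show ?thesis using push_reduced[OF r] ab by simp
qed

text \<open>This is where overlap-freeness enters: the cancelling word has the form
  \<open>v = b @ c\<close>, so \<open>w = a @ b\<close> would overlap it unless \<open>a\<close> and
  \<open>c\<close> are both empty.\<close>

lemma cancels_suffix_word:
  assumes "overlap_free T" "w \<in> T" "w = a @ b" "b \<noteq> []" "cancels T (map Gen b @ s) q"
  shows "b = w \<and> s = Inv w # q"
proof -
  obtain v where v: "v \<in> T" "map Gen b @ s = map Gen v @ Inv v # q"
    using assms(4,5) by (cases b) (auto simp: cancels_def)
  obtain c where c: "v = b @ c" "s = map Gen c @ Inv v # q"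
    using map_Gen_eq_append_Inv[OF v(2)] by blast
  have "\<not> overlap w v" using assms(1,2) v(1) by (auto simp: overlap_free_def)
  then have "a = [] \<and> c = []" using assms(3,4) c(1) unfolding overlap_def by metis
  then show ?thesis using c assms(3) by simp
qed

lemma foldr_push_inv_word:
  assumes "[] \<notin> T" "overlap_free T" "w \<in> T" "reduced T s"
  shows "foldr (push T) ([Inv w] @ map Gen w) s = s"
proof -
  obtain a b where ab: "w = a # b" using assms(1,3) by (cases w) auto
  have red: "reduced T (map Gen b @ s)"
  proof -
    \<comment> \<open>Each \<open>b'\<close> is a proper suffix of \<open>w\<close>, and by
      \<open>cancels_suffix_word\<close> only \<open>w\<close> as a whole can take part in a
      cancellation.\<close>
    have "reduced T (map Gen b' @ s)" if "\<exists>a'. b = a' @ b'" for b'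
      using that
    proof (induction b')
      case Nil
      then show ?case using assms(4) by simp
    next
      case (Cons x b')
      then obtain a' where a': "b = a' @ x # b'" by blast
      then have "\<exists>a''. b = a'' @ b'" by (intro exI[of _ "a' @ [x]"]) simp
      moreover have "\<nexists>q. cancels T (map Gen (x # b') @ s) q"
        using cancels_suffix_word[OF assms(2,3), of "a # a'" "x # b'" s] a' ab by auto
      ultimately show ?case using Cons.IH by (simp add: reduced_Cons)
    qed
    then show ?thesis by blast
  qed
  have f: "foldr (push T) (map Gen w) s = push T (Gen a) (map Gen b @ s)"
    using ab foldr_push_reduced[OF red] by simp
  show ?thesis
  proof (cases "\<exists>q. cancels T (map Gen w @ s) q")
    case True
    then obtain q where q: "cancels T (map Gen w @ s) q" by blast
    then have "s = Inv w # q"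
      using cancels_suffix_word[OF assms(2,3), of "[]" w s q] ab by simp
    moreover have "push T (Gen a) (map Gen b @ s) = q"
      using q ab assms(1) by (intro push_cancel) auto
    \<comment> \<open>Since \<open>s = Inv w # q\<close> is reduced, pushing \<open>Inv w\<close>
      onto \<open>q\<close> puts the deleted letter back without cancelling.\<close>
    ultimately show ?thesis using f assms(4) by (simp add: push_reduced)
  next
    case False
    then have "push T (Gen a) (map Gen b @ s) = map Gen w @ s"
      using ab by (simp add: push_def)
    moreover have "push T (Inv w) (map Gen w @ s) = s"
      using assms(1,3) by (intro push_cancel) (auto simp: cancels_def)
    ultimately show ?thesis using f by simp
  qed
qed

lemma foldr_push_cong:
  assumes "[] \<notin> T" "overlap_free T" "(u, v) \<in> pres_cong G (inverse_rels T)" "reduced T s"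
  shows "foldr (push T) u s = foldr (push T) v s"
  using assms(3,4)
proof (induction arbitrary: s)
  case (rel u v)
  then consider w where "w \<in> T" "u = map Gen w @ [Inv w]" "v = []"
    | w where "w \<in> T" "u = [Inv w] @ map Gen w" "v = []"
    by (auto simp: inverse_rels_def)
  then show ?case
    by cases (simp_all only: foldr_push_word_inv[OF assms(1) _ rel.prems]
        foldr_push_inv_word[OF assms(1,2) _ rel.prems] foldr.simps id_apply)
next
  case (append u v u' v')
  \<comment> \<open>The left factors are applied to the output of the right ones, which must again
    be reduced for the induction hypothesis.\<close>
  then show ?case using reduced_foldr_push[OF assms(1)] by simp
qed auto

section \<open>Strings are congruent to their normal forms\<close>

lemma cancels_cong:
  assumes "cancels T s q" "s \<in> lists G"
  shows "(s, q) \<in> pres_cong G (inverse_rels T)"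
proof -
  obtain w where w: "w \<in> T" "s = (map Gen w @ [Inv w]) @ q \<or> s = ([Inv w] @ map Gen w) @ q"
    using assms(1) by (auto simp: cancels_def)
  have "(map Gen w @ [Inv w], []) \<in> inverse_rels T" "([Inv w] @ map Gen w, []) \<in> inverse_rels T"
    using w(1) unfolding inverse_rels_def by blast+
  then obtain r where r: "(r, []) \<in> inverse_rels T" "s = r @ q"
    using w(2) by blast
  then have "(r, []) \<in> pres_cong G (inverse_rels T)"
    using assms(2) by (intro pres_cong.rel) auto
  moreover have "(q, q) \<in> pres_cong G (inverse_rels T)"
    using assms(2) r(2) by (intro pres_cong.refl) auto
  ultimately show ?thesis using pres_cong.append[of r "[]" G _ q q] r(2) by simp
qed

lemma push_cong:
  assumes "[] \<notin> T" "x # s \<in> lists G"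
  shows "(x # s, push T x s) \<in> pres_cong G (inverse_rels T)"
proof (cases "\<exists>q. cancels T (x # s) q")
  case True
  then show ?thesis using assms cancels_cong push_cancel by metis
next
  case False
  then show ?thesis using pres_cong.refl[OF assms(2)] by (simp add: push_def)
qed

lemma pres_cong_lists: "(u, v) \<in> pres_cong G R \<Longrightarrow> u \<in> lists G \<and> v \<in> lists G"
  using equiv_pres_cong[of G R] by (auto simp: equiv_def)

lemma foldr_push_Nil_cong:
  assumes "[] \<notin> T" "u \<in> lists G"
  shows "(u, foldr (push T) u []) \<in> pres_cong G (inverse_rels T)"
  using assms(2)
proof (induction u)
  case Nil
  show ?case by (simp add: pres_cong.refl)
next
  case (Cons x u)
  then have IH: "(u, foldr (push T) u []) \<in> pres_cong G (inverse_rels T)" by simp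
  have "([x], [x]) \<in> pres_cong G (inverse_rels T)"
    using Cons.hyps by (intro pres_cong.refl) simp
  from pres_cong.append[OF this IH]
  have "(x # u, x # foldr (push T) u []) \<in> pres_cong G (inverse_rels T)" by simp
  moreover from this have "x # foldr (push T) u [] \<in> lists G" using pres_cong_lists by metis
  ultimately show ?case using push_cong[OF assms(1)] by (auto intro: pres_cong.trans)
qed

lemma string_prod_eq_class:
  assumes "s \<in> lists (letters X T)"
  shows "string_prod X T s = pres_cong (letters X T) (inverse_rels T) `` {s}"
  using assms
proof (induction s)
  case Nil
  show ?case by (simp add: string_prod_def adjoin_inverses_def pres_monoid_def)
next
  case (Cons x s)
  then have "string_prod X T (x # s) = pres_cong (letters X T) (inverse_rels T) `` {[x]}
      \<otimes>\<^bsub>adjoin_inverses X T\<^esub> pres_cong (letters X T) (inverse_rels T) `` {s}"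
    by (simp add: string_prod_def pres_gen_def)
  also have "\<dots> = pres_cong (letters X T) (inverse_rels T) `` {[x] @ s}"
    unfolding adjoin_inverses_def using Cons.hyps by (intro mult_pres_monoid) auto
  finally show ?case by simp
qed

theorem proposition3p4:
  fixes X :: "'a set" and T :: "'a list set"
  assumes "T \<subseteq> lists X - {[]}"
    and "overlap_free T"
  shows "\<forall>g \<in> carrier (adjoin_inverses X T).
    \<exists>!s. s \<in> lists (letters X T) \<and> reduced T s \<and> string_prod X T s = g"
proof
  let ?L = "letters X T"
  let ?C = "pres_cong ?L (inverse_rels T)"
  have T: "[] \<notin> T" using assms(1) by blast
  have Nil: "reduced T []" by (simp add: reduced_def)
  fix g assume "g \<in> carrier (adjoin_inverses X T)"
  then obtain u where u: "u \<in> lists ?L" "g = ?C `` {u}"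
    by (auto simp: adjoin_inverses_def pres_monoid_def quotient_def)
  \<comment> \<open>The normal form of \<open>g\<close> is the image of the empty string under any
    representative \<open>u\<close>.\<close>
  define s where "s = foldr (push T) u []"
  have us: "(u, s) \<in> ?C" unfolding s_def using T u(1) by (rule foldr_push_Nil_cong)
  then have s: "s \<in> lists ?L" using pres_cong_lists by metis
  show "\<exists>!s. s \<in> lists ?L \<and> reduced T s \<and> string_prod X T s = g"
  proof (intro ex1I[of _ s] conjI)
    show "reduced T s" unfolding s_def using T Nil by (rule reduced_foldr_push)
    show "string_prod X T s = g"
      using string_prod_eq_class[OF s] equiv_class_eq[OF equiv_pres_cong us] u(2) by simp
  next
    fix t assume t: "t \<in> lists ?L \<and> reduced T t \<and> string_prod X T t = g"
    then have "?C `` {u} = ?C `` {t}" using string_prod_eq_class u(2) by metis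
    then have "(u, t) \<in> ?C"
      using t eq_equiv_class[OF _ equiv_pres_cong] by blast
    \<comment> \<open>Congruent strings act alike on the empty string, and the reduced
      \<open>t\<close> sends it to \<open>t\<close>.\<close>
    then have "s = foldr (push T) t []"
      unfolding s_def using foldr_push_cong[OF T assms(2)] Nil by blast
    then show "t = s" using t foldr_push_reduced[of T t "[]"] by simp
  qed (rule s)
qed

end
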